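(* Let $\ell_x,\ell_y>0$ and let a user (UE) with omnidirectional antenna be located at a point $V$ uniformly distributed in the rectangle $\mathfrak{R}(o)=[-\ell_x/2,\ell_x/2]\times[-\ell_y/2,\ell_y/2]$. It receives transmissions from an access point placed at $u=(u_x,u_y)$ with $|u_x|<\ell_x/2$, $|u_y|<\ell_y/2$, with directional antenna gain $g_t:\mathbb{R}\to(0,\infty)$ (measurable, in linear scale) and bearing angle $\xi\in\mathbb{R}$. Let $(R,\Theta)$ be the polar coordinates of $V-u$ ($R\ge0$, $\Theta\in[0,2\pi)$), and $$\mathrm{SNR}=\frac{g_t(\Theta-\xi)(\tau R)^{-\alpha}|\beta|^2\rho_t}{N_0},$$ where $\tau,\alpha,\rho_t,N_0>0$ are constants and $|\beta|^2$ is exponentially distributed with mean $1$ and independent of $V$. Then for all $t>0$ the coverage probability $\bar F_{\mathrm{SNR}}(t)=\Pr(\mathrm{SNR}\ge t)$ is $$\bar F_{\mathrm{SNR}}(t)=\frac{1}{\ell_x\ell_y}\sum_{i=1}^{8}\Big(\int_0^{h_i}r\,s_i^{(<)}(r)\,dr+\int_{h_i}^{r_{\max}}r\,s_i^{(\ge)}(r)\,dr\Big),$$ where $r_{\max}$ is the distance between $u$ and the farthest vertex of $\mathfrak{R}(o)$ and, for $\mathrm{lb}\in\{<,\ge\}$, $$s_i^{(\mathrm{lb})}(r)=\mathbf 1\big(\chi^{(\mathrm{lb})}_{i,1}(r)<\chi^{(\mathrm{lb})}_{i,2}(r)\big)\int_{\chi^{(\mathrm{lb})}_{i,1}(r)}^{\chi^{(\mathrm{lb})}_{i,2}(r)}\exp\Big(-\frac{tN_0(\tau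 r)^\alpha}{\rho_t\,g_t(\theta-\xi)}\Big)\,d\theta,$$ with $h_i$, $\chi^{(<)}_{i,j}(r)=\chi^{(<)}_{i,j}$ and $\chi^{(\ge)}_{i,j}(r)$ as defined in the context.
   Context: $\mathbf 1(\cdot)$ is the indicator of a condition. Let $h_{x^+}=\frac{\ell_x}{2}-u_x$, $h_{x^-}=-\frac{\ell_x}{2}-u_x$, $h_{y^+}=\frac{\ell_y}{2}-u_y$, $h_{y^-}=-\frac{\ell_y}{2}-u_y$, and $(h_1,\dots,h_8)=(h_{x^+},h_{x^+},-h_{x^-},-h_{x^-},h_{y^+},h_{y^+},-h_{y^-},-h_{y^-})$. Let $\gamma_1=\arctan(h_{y^+}/h_{x^+})$, $\gamma_2=\arctan(h_{y^+}/h_{x^-})+\pi$, $\gamma_3=\arctan(h_{y^-}/h_{x^-})+\pi$, $\gamma_4=\arctan(h_{y^-}/h_{x^+})+2\pi$. The pairs $(\chi^{(<)}_{i,1},\chi^{(<)}_{i,2})$ for $i=1,\dots,8$ (constant in $r$) are: $(0,\gamma_1)$, $(\gamma_4,2\pi)$, $(\pi,\gamma_3)$, $(\gamma_2,\pi)$, $(\gamma_1,\frac{\pi}{2})$, $(\frac{\pi}{2},\gamma_2)$, $(\gamma_3,\frac{3\pi}{2})$, $(\frac{3\pi}{2},\gamma_4)$. For $r\ge h_i$, the pairs $(\chi^{(\ge)}_{i,1}(r),\chi^{(\ge)}_{i,2}(r))$ are: $i=1$: $(\arccos\frac{h_{x^+}}{r},\gamma_1)$; $i=2$: $(\gamma_4,2\pi-\arccos\frac{h_{x^+}}{r})$;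 $i=3$: $(2\pi-\arccos\frac{h_{x^-}}{r},\gamma_3)$; $i=4$: $(\gamma_2,\arccos\frac{h_{x^-}}{r})$; $i=5$: $(\gamma_1,\arcsin\frac{h_{y^+}}{r})$; $i=6$: $(\pi-\arcsin\frac{h_{y^+}}{r},\gamma_2)$; $i=7$: $(\gamma_3,\pi-\arcsin\frac{h_{y^-}}{r})$; $i=8$: $(2\pi+\arcsin\frac{h_{y^-}}{r},\gamma_4)$. *)

theory Defs
  imports "HOL-Probability.Probability"
begin

definition rectangle :: "real \<Rightarrow> real \<Rightarrow> (real \<times> real) set" where
  "rectangle lx ly = {- lx / 2 .. lx / 2} \<times> {- ly / 2 .. ly / 2}"

definition rect_vertices :: "real \<Rightarrow> real \<Rightarrow> (real \<times> real) set" where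
  "rect_vertices lx ly = {- lx / 2, lx / 2} \<times> {- ly / 2, ly / 2}"

definition r_max :: "real \<Rightarrow> real \<Rightarrow> real \<times> real \<Rightarrow> real" where
  "r_max lx ly u = Max (dist u ` rect_vertices lx ly)"

text \<open>
  Polar coordinates; the angle lies in \<open>[0, 2\<pi>)\<close>, and at the origin, where it is not
  determined, it is \<open>0\<close>.
\<close>

definition polar_radius :: "real \<times> real \<Rightarrow> real" where
  "polar_radius v = norm v"

definition polar_angle :: "real \<times> real \<Rightarrow> real" where
  "polar_angle v = Arg2pi (Complex (fst v) (snd v))"

text \<open>
  The received SNR for a user at \<open>v\<close> and a fading power gain \<open>b\<close> (that is, \<open>|\<beta>|\<^sup>2\<close>).
  The parameters are the transmit gain \<open>g\<close>, the bearing angle \<open>\<xi>\<close>, \<open>\<tau>\<close>, the path loss exponent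
  \<open>\<alpha>\<close>, the transmit power \<open>\<rho>\<close>, the noise power \<open>N0\<close> and the access point \<open>u\<close>.
  For \<open>v = u\<close> the path loss factor is infinite in the usual convention, whereas \<open>powr\<close> makes it \<open>0\<close>.
\<close>

definition SNR ::
  "(real \<Rightarrow> real) \<Rightarrow> real \<Rightarrow> real \<Rightarrow> real \<Rightarrow> real \<Rightarrow> real \<Rightarrow> real \<times> real \<Rightarrow> real \<times> real \<Rightarrow> real \<Rightarrow> real"
where
  "SNR g \<xi> \<tau> \<alpha> \<rho> N0 u v b =
     g (polar_angle (v - u) - \<xi>) * (\<tau> * polar_radius (v - u)) powr (- \<alpha>) * b * \<rho> / N0"

definition h_xp :: "real \<Rightarrow> real \<times> real \<Rightarrow> real" where "h_xp lx u = lx / 2 - fst u"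
definition h_xm :: "real \<Rightarrow> real \<times> real \<Rightarrow> real" where "h_xm lx u = - lx / 2 - fst u"
definition h_yp :: "real \<Rightarrow> real \<times> real \<Rightarrow> real" where "h_yp ly u = ly / 2 - snd u"
definition h_ym :: "real \<Rightarrow> real \<times> real \<Rightarrow> real" where "h_ym ly u = - ly / 2 - snd u"

definition \<gamma>1 :: "real \<Rightarrow> real \<Rightarrow> real \<times> real \<Rightarrow> real" where
  "\<gamma>1 lx ly u = arctan (h_yp ly u / h_xp lx u)"
definition \<gamma>2 :: "real \<Rightarrow> real \<Rightarrow> real \<times> real \<Rightarrow> real" where
  "\<gamma>2 lx ly u = arctan (h_yp ly u / h_xm lx u) + pi"
definition \<gamma>3 :: "real \<Rightarrow> real \<Rightarrow> real \<times> real \<Rightarrow> real" where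
  "\<gamma>3 lx ly u = arctan (h_ym ly u / h_xm lx u) + pi"
definition \<gamma>4 :: "real \<Rightarrow> real \<Rightarrow> real \<times> real \<Rightarrow> real" where
  "\<gamma>4 lx ly u = arctan (h_ym ly u / h_xp lx u) + 2 * pi"

text \<open>
  The families below are indexed by \<open>i = 1, \<dots>, 8\<close> and are meaningful only for these \<open>i\<close>;
  lists are indexed from \<open>0\<close>, hence the shift.
\<close>

definition h_dist :: "real \<Rightarrow> real \<Rightarrow> real \<times> real \<Rightarrow> nat \<Rightarrow> real" where
  "h_dist lx ly u i =
     [h_xp lx u, h_xp lx u, - h_xm lx u, - h_xm lx u,
      h_yp ly u, h_yp ly u, - h_ym ly u, - h_ym ly u] ! (i - 1)"

definition chi_lt :: "real \<Rightarrow> real \<Rightarrow> real \<times> real \<Rightarrow> nat \<Rightarrow> real \<Rightarrow> real \<times> real" where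
  "chi_lt lx ly u i r =
     [(0, \<gamma>1 lx ly u),
      (\<gamma>4 lx ly u, 2 * pi),
      (pi, \<gamma>3 lx ly u),
      (\<gamma>2 lx ly u, pi),
      (\<gamma>1 lx ly u, pi / 2),
      (pi / 2, \<gamma>2 lx ly u),
      (\<gamma>3 lx ly u, 3 * pi / 2),
      (3 * pi / 2, \<gamma>4 lx ly u)] ! (i - 1)"

text \<open>Used only for \<open>r \<ge> h_dist lx ly u i\<close>.\<close>

definition chi_ge :: "real \<Rightarrow> real \<Rightarrow> real \<times> real \<Rightarrow> nat \<Rightarrow> real \<Rightarrow> real \<times> real" where
  "chi_ge lx ly u i r =
     [(arccos (h_xp lx u / r), \<gamma>1 lx ly u),
      (\<gamma>4 lx ly u, 2 * pi - arccos (h_xp lx u / r)),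
      (2 * pi - arccos (h_xm lx u / r), \<gamma>3 lx ly u),
      (\<gamma>2 lx ly u, arccos (h_xm lx u / r)),
      (\<gamma>1 lx ly u, arcsin (h_yp ly u / r)),
      (pi - arcsin (h_yp ly u / r), \<gamma>2 lx ly u),
      (\<gamma>3 lx ly u, pi - arcsin (h_ym ly u / r)),
      (2 * pi + arcsin (h_ym ly u / r), \<gamma>4 lx ly u)] ! (i - 1)"

text \<open>
  The function \<open>s\<^sub>i\<close>, for either choice \<open>chi\<close> (with \<open>i\<close> already supplied) of the bounds.
\<close>

definition sector_integral ::
  "(real \<Rightarrow> real) \<Rightarrow> real \<Rightarrow> real \<Rightarrow> real \<Rightarrow> real \<Rightarrow> real \<Rightarrow> real \<Rightarrow> (real \<Rightarrow> real \<times> real) \<Rightarrow> real \<Rightarrow> real"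
where
  "sector_integral g \<xi> \<tau> \<alpha> \<rho> N0 t chi r =
     (if fst (chi r) < snd (chi r) then 1 else 0) *
     (LBINT \<theta>=fst (chi r)..snd (chi r).
        exp (- (t * N0 * (\<tau> * r) powr \<alpha> / (\<rho> * g (\<theta> - \<xi>)))))"

end

theory Submission
  imports Defs
begin

text \<open>
  Conditioning on the position turns the coverage probability into the integral of
  \<open>G r \<theta> = exp (- t N0 (\<tau> r)\<^sup>\<alpha> / (\<rho> g (\<theta> - \<xi>)))\<close> over the rectangle, because the fading is
  exponential. The axes through \<open>u\<close> and the segments from \<open>u\<close> to the vertices cut the rectangle
  into eight right triangles, which rotations by multiples of \<open>\<pi>/2\<close> and reflections carry to the
  standard triangle \<open>0 < x < h\<close>, \<open>0 < y < x k / h\<close>. In polar coordinates, the circle of radius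
  \<open>r\<close> meets that triangle in the arc \<open>0 < \<theta> < arctan (k / h)\<close> if \<open>r < h\<close>, and in
  \<open>arccos (h / r) < \<theta> < arctan (k / h)\<close> otherwise.
\<close>

section \<open>Measurability of the polar angle and of intervals with moving endpoints\<close>

text \<open>\<open>Arg2pi\<close> jumps across the positive real axis, so continuity gives nothing
  here; its sublevel sets are nevertheless closed.\<close>

lemma borel_measurable_Arg2pi [measurable]: "Arg2pi \<in> borel_measurable borel"
  unfolding borel_measurable_iff_le
  using closed_Arg2pi2pi_le by (auto simp: borel_closed)

lemma borel_measurable_polar_angle [measurable]: "polar_angle \<in> borel_measurable borel"
proof -
  have "continuous_on UNIV (\<lambda>v::real \<times> real. Complex (fst v) (snd v))"
    unfolding Complex_eq by (intro continuous_intros)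
  then have [measurable]: "(\<lambda>v. Complex (fst v) (snd v)) \<in> borel_measurable (borel :: (real \<times> real) measure)"
    by (rule borel_measurable_continuous_onI)
  show ?thesis unfolding polar_angle_def by measurable
qed

lemma borel_measurable_tan [measurable]: "(tan :: real \<Rightarrow> real) \<in> borel_measurable borel"
  unfolding tan_def by measurable

text \<open>Serves for regions such as \<open>{0<..<x * (k / h)}\<close>, whose endpoint is itself
  an integration variable: membership unfolds to two comparisons of measurable functions.\<close>

lemma borel_measurable_indicator_greaterThanLessThan [measurable]:
  fixes a b f :: "'a \<Rightarrow> real"
  assumes [measurable]: "a \<in> borel_measurable M" "b \<in> borel_measurable M" "f \<in> borel_measurable M"
  shows "(\<lambda>x. indicator {a x<..<b x} (f x) :: ennreal) \<in> borel_measurable M"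
  unfolding indicator_def greaterThanLessThan_iff by measurable

section \<open>Polar coordinates and right triangles with a vertex at the origin\<close>

lemma polar_angle_polar:
  assumes "r > 0" "0 \<le> \<theta>" "\<theta> < 2 * pi"
  shows "polar_angle (r * cos \<theta>, r * sin \<theta>) = \<theta>"
  unfolding polar_angle_def
  by (rule Arg2pi_unique[of r]) (use assms in \<open>auto simp: complex_eq_iff exp_Euler cos_of_real sin_of_real\<close>)

lemma polar_radius_polar:
  assumes "r > 0"
  shows "polar_radius (r * cos \<theta>, r * sin \<theta>) = r"
proof -
  have "(r * cos \<theta>)\<^sup>2 + (r * sin \<theta>)\<^sup>2 = r\<^sup>2"
    by (simp add: power_mult_distrib flip: distrib_left)
  then show ?thesis using assms
    by (simp add: polar_radius_def norm_Pair)
qed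

text \<open>The region is the open right triangle with vertices \<open>(0, 0)\<close>,
  \<open>(h, 0)\<close> and \<open>(h, k)\<close>. With values in \<open>ennreal\<close>, integrals
  can be swapped and added without integrability conditions.\<close>

definition wedge_integral :: "real \<Rightarrow> real \<Rightarrow> (real \<Rightarrow> real \<Rightarrow> ennreal) \<Rightarrow> ennreal" where
  "wedge_integral h k f =
     (\<integral>\<^sup>+x. (\<integral>\<^sup>+y. f x y * indicator {0<..<x * (k / h)} y \<partial>lborel) * indicator {0<..<h} x \<partial>lborel)"

text \<open>Substitute \<open>y = x tan \<theta>\<close>, swap the integrals, and then substitute \<open>x = r cos \<theta>\<close>.\<close>

lemma wedge_integral_polar:
  fixes f :: "real \<Rightarrow> real \<Rightarrow> real"
  assumes h: "h > 0" and k: "k > 0" and nn: "\<And>x y. f x y \<ge> 0"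
    and f [measurable]: "case_prod f \<in> borel_measurable (borel \<Otimes>\<^sub>M borel)"
  shows "wedge_integral h k (\<lambda>x y. f x y) =
    (\<integral>\<^sup>+r. \<integral>\<^sup>+\<theta>. ennreal (r * f (r * cos \<theta>) (r * sin \<theta>)) *
       indicator {0<..<arctan (k / h)} \<theta> * indicator {0<..} r * indicator {..h} (r * cos \<theta>)
       \<partial>lborel \<partial>lborel)"
proof -
  define \<gamma> where "\<gamma> = arctan (k / h)"
  have \<gamma>: "0 < \<gamma>" "\<gamma> < pi / 2" "tan \<gamma> = k / h"
    using h k arctan_ubound by (auto simp: \<gamma>_def tan_arctan)
  have cos_pos: "cos \<theta> > 0" if "\<theta> \<in> {0..\<gamma>}" for \<theta>
    using that \<gamma> by (intro cos_gt_zero_pi) auto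
  have inner: "(\<integral>\<^sup>+y. ennreal (f x y) * indicator {0<..<x * (k / h)} y \<partial>lborel) =
      (\<integral>\<^sup>+\<theta>. ennreal (f x (x * tan \<theta>) * (x / (cos \<theta>)\<^sup>2)) * indicator {0<..<\<gamma>} \<theta> \<partial>lborel)"
    if x: "x > 0" for x
  proof -
    \<comment> \<open>The substitution rule works with closed intervals; adding the two endpoints
      changes the domain by a null set.\<close>
    have "(\<integral>\<^sup>+y. ennreal (f x y) * indicator {0<..<x * (k / h)} y \<partial>lborel) =
        (\<integral>\<^sup>+y. ennreal (f x y * indicator {x * tan 0..x * tan \<gamma>} y) \<partial>lborel)"
      using AE_lborel_singleton[of "0::real"] AE_lborel_singleton[of "x * (k / h)"]
      by (intro nn_integral_cong_AE) (auto simp: \<gamma> split: split_indicator elim!: eventually_elim2)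
    also have "\<dots> = (\<integral>\<^sup>+\<theta>. ennreal (f x (x * tan \<theta>) * (x / (cos \<theta>)\<^sup>2) * indicator {0..\<gamma>} \<theta>) \<partial>lborel)"
    proof (rule nn_integral_substitution)
      show "set_borel_measurable borel {x * tan 0..x * tan \<gamma>} (f x)"
        unfolding set_borel_measurable_def by measurable
      show "((\<lambda>\<theta>. x * tan \<theta>) has_real_derivative x / (cos \<theta>)\<^sup>2) (at \<theta>)" if "\<theta> \<in> {0..\<gamma>}" for \<theta>
        using cos_pos[OF that]
        by (auto intro!: derivative_eq_intros simp: field_simps)
      show "continuous_on {0..\<gamma>} (\<lambda>\<theta>. x / (cos \<theta>)\<^sup>2)"
        using cos_pos by (intro continuous_intros) fastforce
    qed (use \<gamma> x in auto)
    also have "\<dots> = (\<integral>\<^sup>+\<theta>. ennreal (f x (x * tan \<theta>) * (x / (cos \<theta>)\<^sup>2)) * indicator {0<..<\<gamma>} \<theta> \<partial>lborel)"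
      using AE_lborel_singleton[of "0::real"] AE_lborel_singleton[of \<gamma>]
      by (intro nn_integral_cong_AE) (auto split: split_indicator elim!: eventually_elim2)
    finally show ?thesis .
  qed
  have outer: "(\<integral>\<^sup>+x. ennreal (f x (x * tan \<theta>) * (x / (cos \<theta>)\<^sup>2)) * indicator {0<..<h} x \<partial>lborel) =
      (\<integral>\<^sup>+r. ennreal (r * f (r * cos \<theta>) (r * sin \<theta>)) * indicator {0<..} r * indicator {..h} (r * cos \<theta>) \<partial>lborel)"
    if \<theta>: "\<theta> \<in> {0<..<\<gamma>}" for \<theta>
  proof -
    define c where "c = cos \<theta>"
    have c: "c > 0" using cos_pos[of \<theta>] \<theta> by (auto simp: c_def)
    \<comment> \<open>The target condition \<open>r * cos \<theta> \<le> h\<close> is not strict, so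
      the endpoint \<open>h\<close> is added before scaling.\<close>
    have "(\<integral>\<^sup>+x. ennreal (f x (x * tan \<theta>) * (x / c\<^sup>2)) * indicator {0<..<h} x \<partial>lborel) =
        (\<integral>\<^sup>+x. ennreal (f x (x * tan \<theta>) * (x / c\<^sup>2)) * indicator {0<..h} x \<partial>lborel)"
      using AE_lborel_singleton[of h]
      by (intro nn_integral_cong_AE) (auto split: split_indicator elim!: eventually_mono)
    also have "\<dots> = ennreal c * (\<integral>\<^sup>+r. ennreal (f (c * r) (c * r * tan \<theta>) * (c * r / c\<^sup>2)) * indicator {0<..h} (c * r) \<partial>lborel)"
      using c by (subst nn_integral_real_affine[where c = c and t = 0]) auto
    also have "\<dots> = (\<integral>\<^sup>+r. ennreal c * (ennreal (f (c * r) (c * r * tan \<theta>) * (c * r / c\<^sup>2)) * indicator {0<..h} (c * r)) \<partial>lborel)"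
      by (rule nn_integral_cmult[symmetric]) measurable
    also have "\<dots> = (\<integral>\<^sup>+r. ennreal (r * f (r * cos \<theta>) (r * sin \<theta>)) * indicator {0<..} r * indicator {..h} (r * cos \<theta>) \<partial>lborel)"
    proof (rule nn_integral_cong)
      fix r
      have "c * tan \<theta> = sin \<theta>" using c by (simp add: tan_def c_def)
      then have 1: "c * r * tan \<theta> = r * sin \<theta>" by (metis mult.commute mult.left_commute)
      \<comment> \<open>The factor \<open>c\<close> of the scaling and the factor
        \<open>x / c\<^sup>2\<close> at \<open>x = c * r\<close> combine to the polar Jacobian
        \<open>r\<close>.\<close>
      have 2: "c * (f (c * r) (r * sin \<theta>) * (c * r / c\<^sup>2)) = r * f (r * c) (r * sin \<theta>)"
        using c by (simp add: power2_eq_square field_simps)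
      have "ennreal c * ennreal (f (c * r) (c * r * tan \<theta>) * (c * r / c\<^sup>2)) = ennreal (r * f (r * c) (r * sin \<theta>))"
        if "r > 0"
        unfolding 1 using c that nn by (simp flip: ennreal_mult 2)
      then show "ennreal c * (ennreal (f (c * r) (c * r * tan \<theta>) * (c * r / c\<^sup>2)) * indicator {0<..h} (c * r))
        = ennreal (r * f (r * cos \<theta>) (r * sin \<theta>)) * indicator {0<..} r * indicator {..h} (r * cos \<theta>)"
        using c unfolding c_def[symmetric]
        by (auto split: split_indicator simp: zero_less_mult_iff mult.commute)
    qed
    finally show ?thesis by (simp add: c_def)
  qed
  have "wedge_integral h k (\<lambda>x y. f x y) =
    (\<integral>\<^sup>+x. (\<integral>\<^sup>+\<theta>. ennreal (f x (x * tan \<theta>) * (x / (cos \<theta>)\<^sup>2)) * indicator {0<..<\<gamma>} \<theta> \<partial>lborel) * indicator {0<..<h} x \<partial>lborel)"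
    unfolding wedge_integral_def
    by (intro nn_integral_cong) (auto split: split_indicator simp: inner simp del: times_divide_eq_right)
  also have "\<dots> = (\<integral>\<^sup>+x. \<integral>\<^sup>+\<theta>. ennreal (f x (x * tan \<theta>) * (x / (cos \<theta>)\<^sup>2)) * indicator {0<..<\<gamma>} \<theta> * indicator {0<..<h} x \<partial>lborel \<partial>lborel)"
    by (intro nn_integral_cong nn_integral_multc[symmetric]) measurable
  \<comment> \<open>Once \<open>\<theta>\<close> is fixed, replacing \<open>x\<close> by
    \<open>r * cos \<theta>\<close> is a scaling by a constant; a second swap then restores the
    order of integration.\<close>
  also have "\<dots> = (\<integral>\<^sup>+\<theta>. \<integral>\<^sup>+x. ennreal (f x (x * tan \<theta>) * (x / (cos \<theta>)\<^sup>2)) * indicator {0<..<\<gamma>} \<theta> * indicator {0<..<h} x \<partial>lborel \<partial>lborel)"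
    by (rule lborel_pair.Fubini') measurable
  also have "\<dots> = (\<integral>\<^sup>+\<theta>. \<integral>\<^sup>+r. ennreal (r * f (r * cos \<theta>) (r * sin \<theta>)) *
       indicator {0<..<\<gamma>} \<theta> * indicator {0<..} r * indicator {..h} (r * cos \<theta>) \<partial>lborel \<partial>lborel)"
    proof (rule nn_integral_cong)
    fix \<theta>
    show "(\<integral>\<^sup>+x. ennreal (f x (x * tan \<theta>) * (x / (cos \<theta>)\<^sup>2)) * indicator {0<..<\<gamma>} \<theta> * indicator {0<..<h} x \<partial>lborel) =
      (\<integral>\<^sup>+r. ennreal (r * f (r * cos \<theta>) (r * sin \<theta>)) *
       indicator {0<..<\<gamma>} \<theta> * indicator {0<..} r * indicator {..h} (r * cos \<theta>) \<partial>lborel)"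
      using outer[of \<theta>] by (cases "\<theta> \<in> {0<..<\<gamma>}") simp_all
  qed
  also have "\<dots> = (\<integral>\<^sup>+r. \<integral>\<^sup>+\<theta>. ennreal (r * f (r * cos \<theta>) (r * sin \<theta>)) *
       indicator {0<..<\<gamma>} \<theta> * indicator {0<..} r * indicator {..h} (r * cos \<theta>) \<partial>lborel \<partial>lborel)"
    by (rule lborel_pair.Fubini') measurable
  finally show ?thesis unfolding \<gamma>_def .
qed

text \<open>The diagonal from the origin to \<open>(a, b)\<close> cuts the rectangle into two
  triangles. The upper one has its leg on the second axis and takes the standard form once the
  coordinates exchange roles.\<close>

lemma rectangle_integral_split:
  fixes f :: "real \<Rightarrow> real \<Rightarrow> ennreal"
  assumes a: "a > 0" and b: "b > 0"
    and f [measurable]: "case_prod f \<in> borel_measurable (borel \<Otimes>\<^sub>M borel)"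
  shows "(\<integral>\<^sup>+x. (\<integral>\<^sup>+y. f x y * indicator {0<..<b} y \<partial>lborel) * indicator {0<..<a} x \<partial>lborel) =
    wedge_integral a b f + wedge_integral b a (\<lambda>y x. f x y)"
proof -
  have split: "(\<integral>\<^sup>+y. f x y * indicator {0<..<b} y \<partial>lborel) * indicator {0<..<a} x =
      (\<integral>\<^sup>+y. f x y * indicator {0<..<x * (b / a)} y * indicator {0<..<a} x \<partial>lborel) +
      (\<integral>\<^sup>+y. f x y * indicator {0<..<y * (a / b)} x * indicator {0<..<b} y \<partial>lborel)" for x
  proof -
    have "(\<integral>\<^sup>+y. f x y * indicator {0<..<b} y \<partial>lborel) * indicator {0<..<a} x =
        (\<integral>\<^sup>+y. f x y * indicator {0<..<b} y * indicator {0<..<a} x \<partial>lborel)"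
      by (rule nn_integral_multc[symmetric]) measurable
    also have "\<dots> = (\<integral>\<^sup>+y. f x y * indicator {0<..<x * (b / a)} y * indicator {0<..<a} x +
        f x y * indicator {0<..<y * (a / b)} x * indicator {0<..<b} y \<partial>lborel)"
    proof (rule nn_integral_cong_AE)
      \<comment> \<open>Each triangle indicator carries only one of the bounds \<open>x < a\<close>
        and \<open>y < b\<close>; being on the right side of the diagonal supplies the
        other.\<close>
      have 1: "y < b" if "x < a" "0 < x" "y * a < x * b" for y
      proof -
        have "x * b < a * b" using that b by simp
        with that have "y * a < b * a" by (metis mult.commute order.strict_trans)
        then show ?thesis using a by simp
      qed
      have 2: "x < a" if "y < b" "x * b < y * a" for y
      proof -
        have "y * a < b * a" using that a by simp
        with that have "x * b < a * b" by (metis mult.commute order.strict_trans)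
        then show ?thesis using b by simp
      qed
      \<comment> \<open>Apart from the single point of the diagonal above \<open>x\<close>, exactly
        one of the two slope conditions holds.\<close>
      show "AE y in lborel. f x y * indicator {0<..<b} y * indicator {0<..<a} x =
        f x y * indicator {0<..<x * (b / a)} y * indicator {0<..<a} x +
        f x y * indicator {0<..<y * (a / b)} x * indicator {0<..<b} y"
        using AE_lborel_singleton[of "x * (b / a)"]
      proof eventually_elim
        case (elim y)
        then have "y * a \<noteq> x * b" using a by (auto simp: field_simps)
        moreover have "y < x * (b / a) \<longleftrightarrow> y * a < x * b" "x < y * (a / b) \<longleftrightarrow> x * b < y * a"
          using a b by (auto simp: field_simps)
        moreover have "0 < y" if "0 < x" "x * b < y * a"
          using that a b by (metis mult_pos_pos order.strict_trans zero_less_mult_pos2)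
        ultimately show ?case
          using 1[of y] 2[of y] by (auto split: split_indicator)
      qed
    qed
    also have "\<dots> = (\<integral>\<^sup>+y. f x y * indicator {0<..<x * (b / a)} y * indicator {0<..<a} x \<partial>lborel) +
      (\<integral>\<^sup>+y. f x y * indicator {0<..<y * (a / b)} x * indicator {0<..<b} y \<partial>lborel)"
      by (rule nn_integral_add) measurable
    finally show ?thesis .
  qed
  have "(\<integral>\<^sup>+x. (\<integral>\<^sup>+y. f x y * indicator {0<..<b} y \<partial>lborel) * indicator {0<..<a} x \<partial>lborel) =
     (\<integral>\<^sup>+x. \<integral>\<^sup>+y. f x y * indicator {0<..<x * (b / a)} y * indicator {0<..<a} x \<partial>lborel \<partial>lborel) +
     (\<integral>\<^sup>+x. \<integral>\<^sup>+y. f x y * indicator {0<..<y * (a / b)} x * indicator {0<..<b} y \<partial>lborel \<partial>lborel)"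
    unfolding split by (rule nn_integral_add) measurable
  also have "(\<integral>\<^sup>+x. \<integral>\<^sup>+y. f x y * indicator {0<..<x * (b / a)} y * indicator {0<..<a} x \<partial>lborel \<partial>lborel) =
      wedge_integral a b f"
    unfolding wedge_integral_def
    by (intro nn_integral_cong nn_integral_multc) measurable
  also have "(\<integral>\<^sup>+x. \<integral>\<^sup>+y. f x y * indicator {0<..<y * (a / b)} x * indicator {0<..<b} y \<partial>lborel \<partial>lborel) =
      (\<integral>\<^sup>+y. \<integral>\<^sup>+x. f x y * indicator {0<..<y * (a / b)} x * indicator {0<..<b} y \<partial>lborel \<partial>lborel)"
    by (rule lborel_pair.Fubini') measurable
  also have "\<dots> = wedge_integral b a (\<lambda>y x. f x y)"
    unfolding wedge_integral_def
    by (intro nn_integral_cong nn_integral_multc) measurable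
  finally show ?thesis .
qed

section \<open>Interval integrals and integrals over arcs\<close>

text \<open>A Bochner integral defaults to \<open>0\<close> for a non-integrable function; the bound
  \<open>B\<close> on a bounded interval excludes this case.\<close>

lemma ennreal_interval_integral_eq_nn_integral:
  fixes f :: "real \<Rightarrow> real"
  assumes ab: "a \<le> b" and [measurable]: "f \<in> borel_measurable borel"
    and f: "\<And>x. x \<in> {a<..<b} \<Longrightarrow> 0 \<le> f x" "\<And>x. x \<in> {a<..<b} \<Longrightarrow> f x \<le> B"
  shows "0 \<le> (LBINT x=a..b. f x)"
    and "ennreal (LBINT x=a..b. f x) = (\<integral>\<^sup>+x. ennreal (f x) * indicator {a<..<b} x \<partial>lborel)"
proof -
  have eq: "(LBINT x=a..b. f x) = (LINT x|lborel. indicator {a<..<b} x * f x)"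
    using ab by (simp add: interval_lebesgue_integral_def set_lebesgue_integral_def)
  show "0 \<le> (LBINT x=a..b. f x)"
    unfolding eq using f by (intro integral_nonneg_AE) (auto split: split_indicator)
  have "integrable lborel (\<lambda>x. indicator {a<..<b} x * f x)"
  proof (rule Bochner_Integration.integrable_bound)
    show "integrable lborel (\<lambda>x. indicator {a<..<b} x * \<bar>B\<bar>)"
      using ab by (intro integrable_mult_left integrable_real_indicator) auto
    show "AE x in lborel. norm (indicator {a<..<b} x * f x) \<le> norm (indicator {a<..<b} x * \<bar>B\<bar>)"
      using f by (intro AE_I2) (fastforce split: split_indicator)
  qed measurable
  then have "ennreal (LBINT x=a..b. f x) = (\<integral>\<^sup>+x. ennreal (indicator {a<..<b} x * f x) \<partial>lborel)"
    unfolding eq using f by (intro nn_integral_eq_integral[symmetric]) (auto split: split_indicator)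
  also have "\<dots> = (\<integral>\<^sup>+x. ennreal (f x) * indicator {a<..<b} x \<partial>lborel)"
    by (intro nn_integral_cong) (auto split: split_indicator)
  finally show "ennreal (LBINT x=a..b. f x) = (\<integral>\<^sup>+x. ennreal (f x) * indicator {a<..<b} x \<partial>lborel)" .
qed

text \<open>This is the shape of \<open>sector_integral\<close> for a general integrand. The first
  factor removes reversed bounds, for which the interval integral would be minus the integral over
  \<open>{hi<..<lo}\<close>.\<close>

definition arc_integral :: "(real \<Rightarrow> real) \<Rightarrow> real \<Rightarrow> real \<Rightarrow> real" where
  "arc_integral F lo hi = (if lo < hi then 1 else 0) * (LBINT \<theta>=lo..hi. F \<theta>)"

text \<open>Reversed bounds give an empty interval, so the rules for shifts and reflections need no
  case distinction.\<close>

lemma arc_integral_eq_lborel_integral: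
  "arc_integral F lo hi = (LINT \<theta>|lborel. indicator {lo<..<hi} \<theta> * F \<theta>)"
  by (cases "lo < hi")
    (auto simp: arc_integral_def interval_lebesgue_integral_def set_lebesgue_integral_def)

lemma arc_integral_shift:
  "arc_integral (\<lambda>\<theta>. F (a + \<theta>)) lo hi = arc_integral F (a + lo) (a + hi)"
  unfolding arc_integral_eq_lborel_integral
  by (subst (2) lborel_integral_real_affine[where c = 1 and t = a])
    (auto intro!: Bochner_Integration.integral_cong split: split_indicator)

lemma arc_integral_reflect:
  "arc_integral (\<lambda>\<theta>. F (a - \<theta>)) lo hi = arc_integral F (a - hi) (a - lo)"
  unfolding arc_integral_eq_lborel_integral
  by (subst (2) lborel_integral_real_affine[where c = "-1" and t = a])
    (auto intro!: Bochner_Integration.integral_cong split: split_indicator)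

text \<open>Integrability is not at issue: if the right-hand integral is infinite,
  \<open>enn2real\<close> returns \<open>0\<close>, as the Bochner integral does.\<close>

lemma arc_integral_eq_enn2real:
  assumes "F \<in> borel_measurable borel" "\<And>\<theta>. 0 \<le> F \<theta>"
  shows "arc_integral F lo hi = enn2real (\<integral>\<^sup>+\<theta>. ennreal (F \<theta>) * indicator {lo<..<hi} \<theta> \<partial>lborel)"
  unfolding arc_integral_eq_lborel_integral using assms
  by (subst integral_eq_nn_integral)
    (auto intro!: arg_cong[where f = enn2real] nn_integral_cong split: split_indicator)

text \<open>A circle of radius \<open>r < h\<close> stays to the left of the line
  \<open>x = h\<close>; for \<open>r > h\<close> it does so, among the angles of the wedge, only
  from \<open>arccos (h / r)\<close> on. Beyond the hypotenuse length the bounds of the arc are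
  reversed and contribute nothing, so any larger \<open>R\<close> is an admissible upper limit, and
  eight wedges can share one.\<close>

lemma wedge_integral_arcs:
  fixes f G :: "real \<Rightarrow> real \<Rightarrow> real"
  assumes h: "h > 0" and k: "k > 0" and R: "sqrt (h\<^sup>2 + k\<^sup>2) \<le> R"
    and f [measurable]: "case_prod f \<in> borel_measurable (borel \<Otimes>\<^sub>M borel)"
    and G [measurable]: "case_prod G \<in> borel_measurable (borel \<Otimes>\<^sub>M borel)"
    and f_nn: "\<And>x y. 0 \<le> f x y"
    and G_nn: "\<And>r \<theta>. 0 \<le> G r \<theta>" and G_le: "\<And>r \<theta>. G r \<theta> \<le> 1"
    and polar: "\<And>r \<theta>. 0 < r \<Longrightarrow> 0 < \<theta> \<Longrightarrow> \<theta> < arctan (k / h) \<Longrightarrow> f (r * cos \<theta>) (r * sin \<theta>) = G r \<theta>"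
  defines "I \<equiv> (LBINT r=0..h. r * arc_integral (G r) 0 (arctan (k / h))) +
      (LBINT r=h..R. r * arc_integral (G r) (arccos (h / r)) (arctan (k / h)))"
  shows "0 \<le> I" and "wedge_integral h k (\<lambda>x y. f x y) = ennreal I"
proof -
  define \<gamma> where "\<gamma> = arctan (k / h)"
  have \<gamma>: "0 < \<gamma>" "\<gamma> < pi / 2"
    using h k arctan_ubound by (auto simp: \<gamma>_def)
  \<comment> \<open>Keeping the condition \<open>r * cos \<theta> \<le> h\<close> makes
    \<open>Q\<close> one measurable bounded function for all radii; the explicit arc bounds enter
    only afterwards.\<close>
  define Q where "Q r = (\<integral>\<^sup>+\<theta>. ennreal (G r \<theta>) * indicator {0<..<\<gamma>} \<theta> * indicator {..h} (r * cos \<theta>) \<partial>lborel)" for r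
  have Q_meas [measurable]: "Q \<in> borel_measurable borel"
    unfolding Q_def by measurable
  have Q_le: "Q r \<le> ennreal \<gamma>" for r
  proof -
    have "Q r \<le> (\<integral>\<^sup>+\<theta>. indicator {0<..<\<gamma>} \<theta> \<partial>lborel)"
      unfolding Q_def using G_le by (intro nn_integral_mono) (auto split: split_indicator)
    also have "\<dots> = ennreal \<gamma>" using \<gamma> by simp
    finally show ?thesis .
  qed
  \<comment> \<open>Finiteness matters because \<open>enn2real\<close> sends infinity to
    \<open>0\<close>.\<close>
  have Q_fin: "ennreal (enn2real (Q r)) = Q r" for r
    using Q_le[of r] by (intro ennreal_enn2real) (auto simp: top_unique less_top[symmetric])
  have Q_real: "0 \<le> enn2real (Q r)" "enn2real (Q r) \<le> \<gamma>" for r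
    using Q_le[of r] \<gamma> by (auto intro: enn2real_leI)
  have G_r: "G r \<in> borel_measurable borel" for r by measurable
  have Q_small: "arc_integral (G r) 0 \<gamma> = enn2real (Q r)" if "0 < r" "r < h" for r
  proof -
    have "r * cos \<theta> \<le> h" for \<theta>
      using that mult_left_mono[OF cos_le_one[of \<theta>], of r] by linarith
    then show ?thesis
      by (simp add: arc_integral_eq_enn2real[OF G_r G_nn] Q_def)
  qed
  have cos_le_iff: "r * cos \<theta> \<le> h \<longleftrightarrow> arccos (h / r) \<le> \<theta>"
    if "h < r" "0 < \<theta>" "\<theta> < \<gamma>" for r \<theta>
  proof -
    have "r * cos \<theta> \<le> h \<longleftrightarrow> cos \<theta> \<le> cos (arccos (h / r))"
      using that h by (simp add: cos_arccos field_simps)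
    also have "\<dots> \<longleftrightarrow> arccos (h / r) \<le> \<theta>"
      using that h \<gamma> by (intro cos_mono_le_eq arccos_lbound arccos_ubound) (auto simp: field_simps)
    finally show ?thesis .
  qed
  \<comment> \<open>The two descriptions of the arc differ at most at the angle
    \<open>arccos (h / r)\<close>, where the line \<open>x = h\<close> is met.\<close>
  have Q_big: "arc_integral (G r) (arccos (h / r)) \<gamma> = enn2real (Q r)" if r: "h < r" for r
  proof -
    have "0 \<le> arccos (h / r)"
      using r h by (intro arccos_lbound) (auto simp: field_simps)
    then have "AE \<theta> in lborel. ennreal (G r \<theta>) * indicator {arccos (h / r)<..<\<gamma>} \<theta> =
        ennreal (G r \<theta>) * indicator {0<..<\<gamma>} \<theta> * indicator {..h} (r * cos \<theta>)"
      using AE_lborel_singleton[of "arccos (h / r)"]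
      by (auto split: split_indicator simp: cos_le_iff[OF r] elim!: eventually_mono)
    then show ?thesis
      unfolding arc_integral_eq_enn2real[OF G_r G_nn] Q_def
      by (intro arg_cong[where f = enn2real] nn_integral_cong_AE)
  qed
  have hR: "h < R"
  proof -
    have "h = sqrt (h\<^sup>2)" using h by simp
    also have "\<dots> < sqrt (h\<^sup>2 + k\<^sup>2)" using k by (intro real_sqrt_less_mono) simp
    finally show ?thesis using R by simp
  qed
  have Q_zero: "Q r = 0" if r: "R < r" for r
  proof -
    have "h < r * cos \<theta>" if \<theta>: "0 < \<theta>" "\<theta> < \<gamma>" for \<theta>
    proof -
      \<comment> \<open>The hypotenuse has length \<open>sqrt (h\<^sup>2 + k\<^sup>2)\<close> and
        forms the angle \<open>\<gamma>\<close> with the leg of length \<open>h\<close>; smaller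
        angles have a larger cosine, so a circle beyond the far vertex misses the triangle.\<close>
      have "1 + (k / h)\<^sup>2 = (h\<^sup>2 + k\<^sup>2) / h\<^sup>2"
        using h by (simp add: power_divide add_divide_distrib)
      then have "sqrt (1 + (k / h)\<^sup>2) = sqrt (h\<^sup>2 + k\<^sup>2) / h"
        using h by (simp add: real_sqrt_divide)
      then have "h = sqrt (h\<^sup>2 + k\<^sup>2) * cos \<gamma>"
        using h k by (simp add: \<gamma>_def cos_arctan field_simps add_pos_pos)
      also have "\<dots> \<le> r * cos \<gamma>"
        using R r \<gamma> by (intro mult_right_mono) (auto intro: cos_ge_zero)
      also have "\<dots> < r * cos \<theta>"
        using \<theta> \<gamma> hR h r by (intro mult_strict_left_mono cos_monotone_0_pi) auto
      finally show ?thesis .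
    qed
    then have zero: "indicator {0<..<\<gamma>} \<theta> * indicator {..h} (r * cos \<theta>) = (0::ennreal)" for \<theta>
      by (force split: split_indicator)
    show ?thesis unfolding Q_def mult.assoc zero by simp
  qed
  have polar_r: "(\<integral>\<^sup>+\<theta>. ennreal (r * f (r * cos \<theta>) (r * sin \<theta>)) *
       indicator {0<..<arctan (k / h)} \<theta> * indicator {0<..} r * indicator {..h} (r * cos \<theta>) \<partial>lborel) =
      ennreal (r * enn2real (Q r)) * indicator {0<..} r" for r
  proof (cases "0 < r")
    case True
    have "(\<integral>\<^sup>+\<theta>. ennreal (r * f (r * cos \<theta>) (r * sin \<theta>)) *
       indicator {0<..<\<gamma>} \<theta> * indicator {0<..} r * indicator {..h} (r * cos \<theta>) \<partial>lborel) =
       (\<integral>\<^sup>+\<theta>. ennreal r * (ennreal (G r \<theta>) * indicator {0<..<\<gamma>} \<theta> * indicator {..h} (r * cos \<theta>)) \<partial>lborel)"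
      using True polar[of r] G_nn
      by (intro nn_integral_cong) (auto split: split_indicator simp: \<gamma>_def ennreal_mult)
    also have "\<dots> = ennreal r * Q r"
      unfolding Q_def by (rule nn_integral_cmult) measurable
    also have "\<dots> = ennreal (r * enn2real (Q r))"
      using True by (simp add: ennreal_mult Q_fin)
    finally show ?thesis using True by (simp add: \<gamma>_def)
  qed simp
  \<comment> \<open>Only the open intervals matter here, so the radius \<open>r = h\<close>, left
    out by \<open>Q_small\<close> and \<open>Q_big\<close>, causes no trouble.\<close>
  have I: "I = (LBINT r=0..h. r * enn2real (Q r)) + (LBINT r=h..R. r * enn2real (Q r))"
    unfolding I_def \<gamma>_def[symmetric]
    by (intro arg_cong2[where f = "(+)"] interval_integral_cong)
      (use h hR in \<open>auto simp: Q_small Q_big min_def max_def zero_ereal_def einterval_iff\<close>)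
  have bounds: "0 \<le> r * enn2real (Q r)" "r * enn2real (Q r) \<le> R * \<gamma>" if "0 < r" "r < R" for r
    using that Q_real[of r] \<gamma> by (auto intro!: mult_mono)
  have 1: "0 \<le> (LBINT r=0..h. r * enn2real (Q r))"
      "ennreal (LBINT r=0..h. r * enn2real (Q r)) =
        (\<integral>\<^sup>+r. ennreal (r * enn2real (Q r)) * indicator {0<..<h} r \<partial>lborel)"
    unfolding zero_ereal_def
    by (rule ennreal_interval_integral_eq_nn_integral[where B = "R * \<gamma>"];
        use h hR bounds in \<open>force\<close>)+
  have 2: "0 \<le> (LBINT r=h..R. r * enn2real (Q r))"
      "ennreal (LBINT r=h..R. r * enn2real (Q r)) =
        (\<integral>\<^sup>+r. ennreal (r * enn2real (Q r)) * indicator {h<..<R} r \<partial>lborel)"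
    by (rule ennreal_interval_integral_eq_nn_integral[where B = "R * \<gamma>"];
        use h hR bounds in \<open>force\<close>)+
  show "0 \<le> I" using 1(1) 2(1) by (simp add: I)
  have "wedge_integral h k (\<lambda>x y. f x y) = (\<integral>\<^sup>+r. ennreal (r * enn2real (Q r)) * indicator {0<..} r \<partial>lborel)"
    by (subst wedge_integral_polar[OF h k f_nn f]) (simp only: polar_r)
  \<comment> \<open>\<open>Q_zero\<close> cuts the radii at \<open>R\<close>; the radii
    \<open>h\<close> and \<open>R\<close> themselves are null sets.\<close>
  also have "\<dots> = (\<integral>\<^sup>+r. ennreal (r * enn2real (Q r)) * indicator {0<..<h} r +
      ennreal (r * enn2real (Q r)) * indicator {h<..<R} r \<partial>lborel)"
    using AE_lborel_singleton[of h] AE_lborel_singleton[of R] h hR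
    by (intro nn_integral_cong_AE)
      (auto split: split_indicator simp: Q_zero elim!: eventually_elim2)
  also have "\<dots> = ennreal I"
    using 1 2 by (subst nn_integral_add) (auto simp: I)
  finally show "wedge_integral h k (\<lambda>x y. f x y) = ennreal I" .
qed

section \<open>Cutting the rectangle into eight triangles\<close>

lemma nn_integral_split_at_0:
  fixes f :: "real \<Rightarrow> ennreal"
  assumes [measurable]: "f \<in> borel_measurable borel" and "0 < a" "0 < c"
  shows "(\<integral>\<^sup>+x. f x * indicator {- c<..<a} x \<partial>lborel) =
    (\<integral>\<^sup>+x. f x * indicator {0<..<a} x \<partial>lborel) + (\<integral>\<^sup>+x. f (- x) * indicator {0<..<c} x \<partial>lborel)"
proof -
  have "(\<integral>\<^sup>+x. f x * indicator {- c<..<a} x \<partial>lborel) =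
      (\<integral>\<^sup>+x. f x * indicator {0<..<a} x + f x * indicator {- c<..<0} x \<partial>lborel)"
    using AE_lborel_singleton[of "0::real"] assms
    by (intro nn_integral_cong_AE) (auto split: split_indicator elim!: eventually_mono)
  also have "\<dots> = (\<integral>\<^sup>+x. f x * indicator {0<..<a} x \<partial>lborel) + (\<integral>\<^sup>+x. f x * indicator {- c<..<0} x \<partial>lborel)"
    by (rule nn_integral_add) measurable
  also have "(\<integral>\<^sup>+x. f x * indicator {- c<..<0} x \<partial>lborel) = (\<integral>\<^sup>+x. f (- x) * indicator {- c<..<0} (- x) \<partial>lborel)"
    by (subst nn_integral_real_affine[where c = "-1" and t = 0]) auto
  also have "\<dots> = (\<integral>\<^sup>+x. f (- x) * indicator {0<..<c} x \<partial>lborel)"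
    by (intro nn_integral_cong) (auto split: split_indicator)
  finally show ?thesis .
qed

text \<open>Reflections in the axes carry the four quadrants to the first one, where the diagonal
  splits each in two. The summands are ordered as the indices \<open>1\<close> to \<open>8\<close>
  of \<open>h_dist\<close>, with the distance to the side as first argument.\<close>

lemma rectangle_integral_wedges:
  fixes f :: "real \<Rightarrow> real \<Rightarrow> ennreal"
  assumes pos: "0 < a" "0 < b" "0 < c" "0 < d"
    and f [measurable]: "case_prod f \<in> borel_measurable (borel \<Otimes>\<^sub>M borel)"
  shows "(\<integral>\<^sup>+x. (\<integral>\<^sup>+y. f x y * indicator {- d<..<b} y \<partial>lborel) * indicator {- c<..<a} x \<partial>lborel) =
    wedge_integral a b (\<lambda>x y. f x y) + wedge_integral a d (\<lambda>x y. f x (- y)) +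
    wedge_integral c d (\<lambda>x y. f (- x) (- y)) + wedge_integral c b (\<lambda>x y. f (- x) y) +
    wedge_integral b a (\<lambda>x y. f y x) + wedge_integral b c (\<lambda>x y. f (- y) x) +
    wedge_integral d c (\<lambda>x y. f (- y) (- x)) + wedge_integral d a (\<lambda>x y. f y (- x))"
proof -
  have inner: "(\<integral>\<^sup>+y. f x y * indicator {- d<..<b} y \<partial>lborel) =
      (\<integral>\<^sup>+y. f x y * indicator {0<..<b} y \<partial>lborel) + (\<integral>\<^sup>+y. f x (- y) * indicator {0<..<d} y \<partial>lborel)" for x
    using pos by (intro nn_integral_split_at_0) measurable
  have "(\<integral>\<^sup>+x. (\<integral>\<^sup>+y. f x y * indicator {- d<..<b} y \<partial>lborel) * indicator {- c<..<a} x \<partial>lborel) =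
    (\<integral>\<^sup>+x. (\<integral>\<^sup>+y. f x y * indicator {0<..<b} y \<partial>lborel) * indicator {0<..<a} x +
       (\<integral>\<^sup>+y. f x (- y) * indicator {0<..<d} y \<partial>lborel) * indicator {0<..<a} x \<partial>lborel) +
    (\<integral>\<^sup>+x. (\<integral>\<^sup>+y. f (- x) y * indicator {0<..<b} y \<partial>lborel) * indicator {0<..<c} x +
       (\<integral>\<^sup>+y. f (- x) (- y) * indicator {0<..<d} y \<partial>lborel) * indicator {0<..<c} x \<partial>lborel)"
    using pos by (subst nn_integral_split_at_0) (simp_all add: inner distrib_right)
  also have "\<dots> =
    (\<integral>\<^sup>+x. (\<integral>\<^sup>+y. f x y * indicator {0<..<b} y \<partial>lborel) * indicator {0<..<a} x \<partial>lborel) +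
    (\<integral>\<^sup>+x. (\<integral>\<^sup>+y. f x (- y) * indicator {0<..<d} y \<partial>lborel) * indicator {0<..<a} x \<partial>lborel) +
    ((\<integral>\<^sup>+x. (\<integral>\<^sup>+y. f (- x) y * indicator {0<..<b} y \<partial>lborel) * indicator {0<..<c} x \<partial>lborel) +
    (\<integral>\<^sup>+x. (\<integral>\<^sup>+y. f (- x) (- y) * indicator {0<..<d} y \<partial>lborel) * indicator {0<..<c} x \<partial>lborel))"
    by (intro arg_cong2[where f = "(+)"] nn_integral_add) measurable
  also have "\<dots> =
    wedge_integral a b (\<lambda>x y. f x y) + wedge_integral b a (\<lambda>x y. f y x) +
    (wedge_integral a d (\<lambda>x y. f x (- y)) + wedge_integral d a (\<lambda>x y. f y (- x))) +
    ((wedge_integral c b (\<lambda>x y. f (- x) y) + wedge_integral b c (\<lambda>x y. f (- y) x)) +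
    (wedge_integral c d (\<lambda>x y. f (- x) (- y)) + wedge_integral d c (\<lambda>x y. f (- y) (- x))))"
    using pos by (intro arg_cong2[where f = "(+)"] rectangle_integral_split) measurable
  finally show ?thesis by (simp only: ac_simps)
qed

section \<open>Triangles in the eight positions around the access point\<close>

text \<open>One summand of the coverage formula, with \<open>clt\<close> and \<open>cge\<close> in
  place of \<open>chi_lt\<close> and \<open>chi_ge\<close> at a fixed index.\<close>

definition arc_bounds_integral ::
  "(real \<Rightarrow> real \<Rightarrow> real) \<Rightarrow> real \<Rightarrow> real \<Rightarrow> (real \<Rightarrow> real \<times> real) \<Rightarrow> (real \<Rightarrow> real \<times> real) \<Rightarrow> real" where
  "arc_bounds_integral G h R clt cge =
     (LBINT r=0..h. r * arc_integral (G r) (fst (clt r)) (snd (clt r))) +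
     (LBINT r=h..R. r * arc_integral (G r) (fst (cge r)) (snd (cge r)))"

text \<open>\<open>f\<close> and \<open>G\<close> are one integrand in Cartesian and in polar
  coordinates. The gain need not be periodic, so \<open>f_polar\<close> is confined to angles in the
  range of \<open>polar_angle\<close>, and every triangle must be placed within
  \<open>[0, 2 * pi)\<close>.\<close>

locale polar_density =
  fixes f G :: "real \<Rightarrow> real \<Rightarrow> real" and R :: real
  assumes f [measurable]: "case_prod f \<in> borel_measurable (borel \<Otimes>\<^sub>M borel)"
    and G [measurable]: "case_prod G \<in> borel_measurable (borel \<Otimes>\<^sub>M borel)"
    and f_nonneg: "\<And>x y. 0 \<le> f x y"
    and G_nonneg: "\<And>r \<theta>. 0 \<le> G r \<theta>" and G_le_1: "\<And>r \<theta>. G r \<theta> \<le> 1"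
    and f_polar: "\<And>r \<theta>. 0 < r \<Longrightarrow> 0 \<le> \<theta> \<Longrightarrow> \<theta> < 2 * pi \<Longrightarrow> f (r * cos \<theta>) (r * sin \<theta>) = G r \<theta>"
begin

text \<open>\<open>(X, Y)\<close> is the rotation by \<open>a\<close>, the direction of the leg of
  length \<open>h\<close>, and the triangle lies after that direction. As its angle is below
  \<open>pi / 2\<close>, the bounds on \<open>a\<close> keep \<open>a + \<theta>\<close> within
  \<open>[0, 2 * pi)\<close>. The equation for \<open>cge\<close> is asked only for
  \<open>h < r\<close>, where the quotients in \<open>chi_ge\<close> lie in the domain of
  \<open>arccos\<close> and \<open>arcsin\<close>.\<close>

lemma wedge_integral_anticlockwise:
  fixes X Y :: "real \<Rightarrow> real \<Rightarrow> real"
  assumes h: "0 < h" and k: "0 < k" and R: "sqrt (h\<^sup>2 + k\<^sup>2) \<le> R"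
    and [measurable]: "case_prod X \<in> borel_measurable (borel \<Otimes>\<^sub>M borel)"
      "case_prod Y \<in> borel_measurable (borel \<Otimes>\<^sub>M borel)"
    and X: "\<And>r \<theta>. X (r * cos \<theta>) (r * sin \<theta>) = r * cos (a + \<theta>)"
    and Y: "\<And>r \<theta>. Y (r * cos \<theta>) (r * sin \<theta>) = r * sin (a + \<theta>)"
    and a: "0 \<le> a" "a \<le> 3 * pi / 2"
    and clt: "\<And>r. clt r = (a, a + arctan (k / h))"
    and cge: "\<And>r. h < r \<Longrightarrow> cge r = (a + arccos (h / r), a + arctan (k / h))"
  shows "0 \<le> arc_bounds_integral G h R clt cge"
    and "wedge_integral h k (\<lambda>x y. f (X x y) (Y x y)) = ennreal (arc_bounds_integral G h R clt cge)"
proof -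
  have hR: "h \<le> R"
    using R h by (meson order_trans real_le_rsqrt le_add_same_cancel1 zero_le_power2)
  have polar: "f (X (r * cos \<theta>) (r * sin \<theta>)) (Y (r * cos \<theta>) (r * sin \<theta>)) = G r (a + \<theta>)"
    if "0 < r" "0 < \<theta>" "\<theta> < arctan (k / h)" for r \<theta>
    using that a arctan_ubound[of "k / h"] unfolding X Y by (intro f_polar) auto
  have eq: "arc_bounds_integral G h R clt cge =
      (LBINT r=0..h. r * arc_integral (\<lambda>\<theta>. G r (a + \<theta>)) 0 (arctan (k / h))) +
      (LBINT r=h..R. r * arc_integral (\<lambda>\<theta>. G r (a + \<theta>)) (arccos (h / r)) (arctan (k / h)))"
    unfolding arc_bounds_integral_def
    by (intro arg_cong2[where f = "(+)"] interval_integral_cong)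
      (use h hR in \<open>auto simp: arc_integral_shift[of "G _"] clt cge min_def einterval_iff\<close>)
  have meas: "(\<lambda>(x, y). f (X x y) (Y x y)) \<in> borel_measurable (borel \<Otimes>\<^sub>M borel)"
    "(\<lambda>(r, \<theta>). G r (a + \<theta>)) \<in> borel_measurable (borel \<Otimes>\<^sub>M borel)"
    by measurable
  show "0 \<le> arc_bounds_integral G h R clt cge"
    and "wedge_integral h k (\<lambda>x y. f (X x y) (Y x y)) = ennreal (arc_bounds_integral G h R clt cge)"
    unfolding eq
    by (rule wedge_integral_arcs[OF h k R meas]; fact f_nonneg G_nonneg G_le_1 polar)+
qed

text \<open>The mirror image: \<open>(X, Y)\<close> is a reflection, the triangle lies before the
  direction \<open>a\<close>, and the arc ends there instead of starting there. Since
  \<open>\<theta>\<close> is positive, \<open>a = 2 * pi\<close> is allowed.\<close>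

lemma wedge_integral_clockwise:
  fixes X Y :: "real \<Rightarrow> real \<Rightarrow> real"
  assumes h: "0 < h" and k: "0 < k" and R: "sqrt (h\<^sup>2 + k\<^sup>2) \<le> R"
    and [measurable]: "case_prod X \<in> borel_measurable (borel \<Otimes>\<^sub>M borel)"
      "case_prod Y \<in> borel_measurable (borel \<Otimes>\<^sub>M borel)"
    and X: "\<And>r \<theta>. X (r * cos \<theta>) (r * sin \<theta>) = r * cos (a - \<theta>)"
    and Y: "\<And>r \<theta>. Y (r * cos \<theta>) (r * sin \<theta>) = r * sin (a - \<theta>)"
    and a: "pi / 2 \<le> a" "a \<le> 2 * pi"
    and clt: "\<And>r. clt r = (a - arctan (k / h), a)"
    and cge: "\<And>r. h < r \<Longrightarrow> cge r = (a - arctan (k / h), a - arccos (h / r))"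
  shows "0 \<le> arc_bounds_integral G h R clt cge"
    and "wedge_integral h k (\<lambda>x y. f (X x y) (Y x y)) = ennreal (arc_bounds_integral G h R clt cge)"
proof -
  have hR: "h \<le> R"
    using R h by (meson order_trans real_le_rsqrt le_add_same_cancel1 zero_le_power2)
  have polar: "f (X (r * cos \<theta>) (r * sin \<theta>)) (Y (r * cos \<theta>) (r * sin \<theta>)) = G r (a - \<theta>)"
    if "0 < r" "0 < \<theta>" "\<theta> < arctan (k / h)" for r \<theta>
    using that a arctan_ubound[of "k / h"] unfolding X Y by (intro f_polar) auto
  have eq: "arc_bounds_integral G h R clt cge =
      (LBINT r=0..h. r * arc_integral (\<lambda>\<theta>. G r (a - \<theta>)) 0 (arctan (k / h))) +
      (LBINT r=h..R. r * arc_integral (\<lambda>\<theta>. G r (a - \<theta>)) (arccos (h / r)) (arctan (k / h)))"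
    unfolding arc_bounds_integral_def
    by (intro arg_cong2[where f = "(+)"] interval_integral_cong)
      (use h hR in \<open>auto simp: arc_integral_reflect[of "G _"] clt cge min_def einterval_iff\<close>)
  have meas: "(\<lambda>(x, y). f (X x y) (Y x y)) \<in> borel_measurable (borel \<Otimes>\<^sub>M borel)"
    "(\<lambda>(r, \<theta>). G r (a - \<theta>)) \<in> borel_measurable (borel \<Otimes>\<^sub>M borel)"
    by measurable
  show "0 \<le> arc_bounds_integral G h R clt cge"
    and "wedge_integral h k (\<lambda>x y. f (X x y) (Y x y)) = ennreal (arc_bounds_integral G h R clt cge)"
    unfolding eq
    by (rule wedge_integral_arcs[OF h k R meas]; fact f_nonneg G_nonneg G_le_1 polar)+
qed

end

section \<open>Independence and the exponential tail\<close>

text \<open>A product of sigma-finite measures is determined by its values on the sets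
  \<open>A \<times> B\<close>, and there independence is exactly the product rule.\<close>

lemma (in prob_space) distr_pair_indep_set:
  assumes X [measurable]: "X \<in> measurable M S" and Y [measurable]: "Y \<in> measurable M T"
    and indep: "indep_set {X -` A \<inter> space M | A. A \<in> sets S} {Y -` A \<inter> space M | A. A \<in> sets T}"
  shows "distr M S X \<Otimes>\<^sub>M distr M T Y = distr M (S \<Otimes>\<^sub>M T) (\<lambda>\<omega>. (X \<omega>, Y \<omega>))"
proof (rule pair_measure_eqI)
  interpret X: prob_space "distr M S X" by (rule prob_space_distr) measurable
  interpret Y: prob_space "distr M T Y" by (rule prob_space_distr) measurable
  show "sigma_finite_measure (distr M S X)" "sigma_finite_measure (distr M T Y)"
    by unfold_locales
  show "sets (distr M S X \<Otimes>\<^sub>M distr M T Y) = sets (distr M (S \<Otimes>\<^sub>M T) (\<lambda>\<omega>. (X \<omega>, Y \<omega>)))"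
    by (simp cong: sets_pair_measure_cong)
  fix A B assume "A \<in> sets (distr M S X)" "B \<in> sets (distr M T Y)"
  then have A [measurable]: "A \<in> sets S" and B [measurable]: "B \<in> sets T" by auto
  have "prob ((X -` A \<inter> space M) \<inter> (Y -` B \<inter> space M)) = prob (X -` A \<inter> space M) * prob (Y -` B \<inter> space M)"
    using A B by (intro indep_setD[OF indep]) auto
  moreover have "(\<lambda>\<omega>. (X \<omega>, Y \<omega>)) -` (A \<times> B) \<inter> space M = (X -` A \<inter> space M) \<inter> (Y -` B \<inter> space M)"
    by auto
  ultimately show "emeasure (distr M S X) A * emeasure (distr M T Y) B =
      emeasure (distr M (S \<Otimes>\<^sub>M T) (\<lambda>\<omega>. (X \<omega>, Y \<omega>))) (A \<times> B)"
    by (simp add: emeasure_distr emeasure_eq_measure ennreal_mult)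
qed

text \<open>Given \<open>V = v\<close>, the event is the tail \<open>{c v..}\<close> of the law of
  \<open>B\<close>. The tail formula \<open>exp (- a)\<close> holds for \<open>a \<ge> 0\<close>
  only, hence the sign condition on \<open>c\<close>.\<close>

lemma (in prob_space) emeasure_exponential_ge:
  assumes V [measurable]: "random_variable borel V"
    and indep: "indep_set {V -` A \<inter> space M | A. A \<in> sets borel} {B -` A \<inter> space M | A. A \<in> sets borel}"
    and B: "distributed M lborel B (exponential_density 1)"
    and c [measurable]: "c \<in> borel_measurable borel" and c_nn: "\<And>v. 0 \<le> c v"
  shows "emeasure M {\<omega> \<in> space M. c (V \<omega>) \<le> B \<omega>} =
    (\<integral>\<^sup>+v. ennreal (exp (- c v)) \<partial>distr M borel V)"
proof -
  have rv [measurable]: "random_variable borel B"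
    using distributed_measurable[OF B] by simp
  have joint: "distr M borel V \<Otimes>\<^sub>M distr M borel B = distr M (borel \<Otimes>\<^sub>M borel) (\<lambda>\<omega>. (V \<omega>, B \<omega>))"
    by (rule distr_pair_indep_set[OF V rv indep])
  interpret D: prob_space "distr M borel B"
    by (rule prob_space_distr) measurable
  have tail: "emeasure (distr M borel B) {a..} = ennreal (exp (- a))" if "0 \<le> a" for a
  proof -
    \<comment> \<open>The exponential law has no atoms, so the formula for the strict tail also
      covers the closed one.\<close>
    have "AE \<omega> in M. B \<omega> \<noteq> a"
    proof -
      have "AE x in density lborel (exponential_density 1). x \<noteq> a"
        using AE_lborel_singleton[of a] by (subst AE_density) (auto elim: eventually_mono)
      then have "AE x in distr M lborel B. x \<noteq> a"
        unfolding distributed_distr_eq_density[OF B] .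
      then show ?thesis by (rule AE_distrD[rotated]) simp
    qed
    then have "emeasure M {\<omega> \<in> space M. a \<le> B \<omega>} = emeasure M {\<omega> \<in> space M. a < B \<omega>}"
      by (intro emeasure_eq_AE) (auto elim!: eventually_mono)
    also have "\<dots> = ennreal (exp (- a))"
      using exponential_distributedD_gt[OF B that] by (simp add: emeasure_eq_measure)
    finally show ?thesis
      by (subst emeasure_distr) (auto simp: vimage_def Int_def conj_commute)
  qed
  let ?A = "{z \<in> space (borel \<Otimes>\<^sub>M borel). c (fst z) \<le> snd z}"
  have A: "?A \<in> sets (borel \<Otimes>\<^sub>M borel)" by measurable
  have "emeasure M {\<omega> \<in> space M. c (V \<omega>) \<le> B \<omega>} =
      emeasure (distr M (borel \<Otimes>\<^sub>M borel) (\<lambda>\<omega>. (V \<omega>, B \<omega>))) ?A"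
    by (subst emeasure_distr[OF _ A]) (auto simp: space_pair_measure intro!: arg_cong[where f = "emeasure M"])
  also have "\<dots> = (\<integral>\<^sup>+v. emeasure (distr M borel B) (Pair v -` ?A) \<partial>distr M borel V)"
    unfolding joint[symmetric] by (rule D.emeasure_pair_measure_alt)
      (subst sets_pair_measure_cong[OF sets_distr sets_distr], fact A)
  also have "\<dots> = (\<integral>\<^sup>+v. ennreal (exp (- c v)) \<partial>distr M borel V)"
  proof (rule nn_integral_cong)
    fix v
    have "Pair v -` ?A = {c v..}" by (auto simp: space_pair_measure)
    then show "emeasure (distr M borel B) (Pair v -` ?A) = ennreal (exp (- c v))"
      using tail[OF c_nn] by simp
  qed
  finally show ?thesis .
qed

section \<open>The rectangle as seen from the access point\<close>

lemma nn_integral_Icc_eq_Ioo: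
  fixes f :: "real \<Rightarrow> ennreal"
  shows "(\<integral>\<^sup>+x. f x * indicator {p..q} x \<partial>lborel) = (\<integral>\<^sup>+x. f x * indicator {p<..<q} x \<partial>lborel)"
  using AE_lborel_singleton[of p] AE_lborel_singleton[of q]
  by (intro nn_integral_cong_AE) (auto split: split_indicator elim!: eventually_elim2)

lemma measure_rectangle:
  assumes "0 \<le> lx" "0 \<le> ly"
  shows "measure lborel (rectangle lx ly) = lx * ly"
proof -
  have "emeasure lborel (rectangle lx ly) = ennreal (lx * ly)"
    unfolding rectangle_def lborel_prod[symmetric] using assms
    by (subst lborel.emeasure_pair_measure_Times) (auto simp: ennreal_mult)
  then show ?thesis using assms by (simp add: measure_def)
qed

lemma rectangle_sets [measurable]: "rectangle lx ly \<in> sets borel"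
  unfolding rectangle_def by (intro borel_closed closed_Times) auto

text \<open>Translation invariance of Lebesgue measure moves the access point to the origin; the
  edges of the rectangle are null sets.\<close>

lemma nn_integral_rectangle_translate:
  fixes F :: "real \<times> real \<Rightarrow> ennreal"
  assumes [measurable]: "F \<in> borel_measurable borel"
  shows "(\<integral>\<^sup>+v. F (v - u) * indicator (rectangle lx ly) v \<partial>lborel) =
    (\<integral>\<^sup>+x. (\<integral>\<^sup>+y. F (x, y) * indicator {h_ym ly u<..<h_yp ly u} y \<partial>lborel) *
       indicator {h_xm lx u<..<h_xp lx u} x \<partial>lborel)"
proof -
  have F_pair [measurable]: "(\<lambda>(x, y). F (x, y)) \<in> borel_measurable (borel \<Otimes>\<^sub>M borel)"
    by (simp add: borel_prod)
  have "(\<integral>\<^sup>+v. F (v - u) * indicator (rectangle lx ly) v \<partial>lborel) =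
      (\<integral>\<^sup>+v. F (v - u) * indicator (rectangle lx ly) v \<partial>distr lborel borel ((+) u))"
    by (simp add: lborel_distr_plus)
  also have "\<dots> = (\<integral>\<^sup>+w. F w * indicator (rectangle lx ly) (u + w) \<partial>lborel)"
    by (subst nn_integral_distr) auto
  also have "\<dots> = (\<integral>\<^sup>+x. \<integral>\<^sup>+y. F (x, y) * indicator (rectangle lx ly) (u + (x, y)) \<partial>lborel \<partial>lborel)"
    unfolding lborel_prod[symmetric]
    by (rule lborel.nn_integral_fst[symmetric]) (simp add: lborel_prod)
  also have "\<dots> = (\<integral>\<^sup>+x. \<integral>\<^sup>+y. F (x, y) * indicator {h_ym ly u..h_yp ly u} y *
      indicator {h_xm lx u..h_xp lx u} x \<partial>lborel \<partial>lborel)"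
    by (intro nn_integral_cong)
      (cases u, auto split: split_indicator simp: rectangle_def h_xm_def h_xp_def h_ym_def h_yp_def)
  also have "\<dots> = (\<integral>\<^sup>+x. (\<integral>\<^sup>+y. F (x, y) * indicator {h_ym ly u..h_yp ly u} y \<partial>lborel) *
      indicator {h_xm lx u..h_xp lx u} x \<partial>lborel)"
    by (intro nn_integral_cong nn_integral_multc) measurable
  finally show ?thesis by (simp only: nn_integral_Icc_eq_Ioo)
qed

text \<open>The acute angles of a right triangle are complementary. In sectors \<open>5\<close> to
  \<open>8\<close> the leg lies on the vertical axis, whereas the angles of the vertices are given
  relative to the horizontal one.\<close>

lemma arctan_divide_swap:
  assumes "0 < a" "0 < b"
  shows "arctan (b / a) = pi / 2 - arctan (a / b)"
  using arctan_inverse[of "a / b"] assms by simp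

lemma arcsin_eq_arccos:
  assumes "-1 \<le> y" "y \<le> 1"
  shows "arcsin y = pi / 2 - arccos y"
  using arccos_bounded[OF assms] assms
  by (intro arcsin_unique) (auto simp: sin_diff)

lemma dist_vertex_le_r_max:
  assumes "v \<in> rect_vertices lx ly"
  shows "dist u v \<le> r_max lx ly u"
  unfolding r_max_def using assms
  by (intro Max_ge) (auto simp: rect_vertices_def)

lemma sqrt_le_r_max:
  shows "sqrt ((h_xp lx u)\<^sup>2 + (h_yp ly u)\<^sup>2) \<le> r_max lx ly u"
    and "sqrt ((h_xp lx u)\<^sup>2 + (h_ym ly u)\<^sup>2) \<le> r_max lx ly u"
    and "sqrt ((h_xm lx u)\<^sup>2 + (h_yp ly u)\<^sup>2) \<le> r_max lx ly u"
    and "sqrt ((h_xm lx u)\<^sup>2 + (h_ym ly u)\<^sup>2) \<le> r_max lx ly u"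
  using dist_vertex_le_r_max[of "(lx / 2, ly / 2)" lx ly u]
    dist_vertex_le_r_max[of "(lx / 2, - ly / 2)" lx ly u]
    dist_vertex_le_r_max[of "(- lx / 2, ly / 2)" lx ly u]
    dist_vertex_le_r_max[of "(- lx / 2, - ly / 2)" lx ly u]
  by (cases u; simp add: rect_vertices_def dist_Pair_Pair dist_real_def h_xp_def h_xm_def h_yp_def h_ym_def power2_commute)+

text \<open>Each of the eight wedges is matched with its index by an isometry that puts the leg of
  length \<open>h_dist lx ly u i\<close> on the half-axis at angle \<open>a\<close>.\<close>

lemma (in polar_density) rectangle_integral_polar:
  assumes R_eq: "R = r_max lx ly u"
    and pos: "0 < h_xp lx u" "h_xm lx u < 0" "0 < h_yp ly u" "h_ym ly u < 0"
  defines "J \<equiv> \<lambda>i. arc_bounds_integral G (h_dist lx ly u i) R (chi_lt lx ly u i) (chi_ge lx ly u i)"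
  shows "0 \<le> (\<Sum>i=1..8. J i)"
    and "(\<integral>\<^sup>+x. (\<integral>\<^sup>+y. ennreal (f x y) * indicator {h_ym ly u<..<h_yp ly u} y \<partial>lborel) *
       indicator {h_xm lx u<..<h_xp lx u} x \<partial>lborel) = ennreal (\<Sum>i=1..8. J i)"
proof -
  define a where "a = h_xp lx u"
  define b where "b = h_yp ly u"
  define c where "c = - h_xm lx u"
  define d where "d = - h_ym ly u"
  have h_eq: "h_xp lx u = a" "h_yp ly u = b" "h_xm lx u = - c" "h_ym ly u = - d"
    by (simp_all add: a_def b_def c_def d_def)
  have p: "0 < a" "0 < b" "0 < c" "0 < d"
    using pos by (simp_all add: h_eq)
  have R: "sqrt (a\<^sup>2 + b\<^sup>2) \<le> R" "sqrt (a\<^sup>2 + d\<^sup>2) \<le> R" "sqrt (c\<^sup>2 + b\<^sup>2) \<le> R" "sqrt (c\<^sup>2 + d\<^sup>2) \<le> R"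
    "sqrt (b\<^sup>2 + a\<^sup>2) \<le> R" "sqrt (d\<^sup>2 + a\<^sup>2) \<le> R" "sqrt (b\<^sup>2 + c\<^sup>2) \<le> R" "sqrt (d\<^sup>2 + c\<^sup>2) \<le> R"
    using sqrt_le_r_max[of lx u ly] by (simp_all add: R_eq h_eq add.commute)
  \<comment> \<open>As \<open>arctan\<close> is odd, the angle of every vertex is a multiple of
    \<open>pi\<close> plus or minus an acute angle.\<close>
  have \<gamma>: "\<gamma>1 lx ly u = arctan (b / a)" "\<gamma>2 lx ly u = pi - arctan (b / c)"
    "\<gamma>3 lx ly u = pi + arctan (d / c)" "\<gamma>4 lx ly u = 2 * pi - arctan (d / a)"
    by (simp_all add: \<gamma>1_def \<gamma>2_def \<gamma>3_def \<gamma>4_def h_eq arctan_minus)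
  \<comment> \<open>All bounds of \<open>chi_ge\<close> are brought to a multiple of
    \<open>pi / 2\<close> plus or minus \<open>arccos (z / r)\<close> with \<open>z\<close>
    positive, the form required by the two wedge lemmas.\<close>
  have arc: "arccos (- (z / r)) = pi - arccos (z / r)" "arcsin (z / r) = pi / 2 - arccos (z / r)"
    "arcsin (- (z / r)) = arccos (z / r) - pi / 2" if "0 < z" "z < r" for z r
  proof -
    have z: "-1 \<le> z / r" "z / r \<le> 1" using that by (auto simp: field_simps)
    show "arccos (- (z / r)) = pi - arccos (z / r)" "arcsin (z / r) = pi / 2 - arccos (z / r)"
      "arcsin (- (z / r)) = arccos (z / r) - pi / 2"
      using z by (simp_all add: arccos_minus arcsin_minus arcsin_eq_arccos)
  qed
  note defs = h_dist_def chi_lt_def chi_ge_def \<gamma> h_eq arc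
  have cos3: "cos (3 * pi / 2) = 0" "sin (3 * pi / 2) = - 1"
    using cos_3over2_pi sin_3over2_pi by (simp_all add: field_simps)
  \<comment> \<open>The wedge is anticlockwise (\<open>1\<close>, \<open>3\<close>,
    \<open>6\<close>, \<open>8\<close>) if its vertex follows the half-axis at angle
    \<open>a\<close>, clockwise (\<open>2\<close>, \<open>4\<close>, \<open>5\<close>,
    \<open>7\<close>) if it precedes it. The half-axis at angle \<open>0\<close> is taken as
    \<open>2 * pi\<close> for sector \<open>2\<close>.\<close>
  have sec: "0 \<le> J 1 \<and> wedge_integral a b (\<lambda>x y. f x y) = ennreal (J 1)"
    "0 \<le> J 2 \<and> wedge_integral a d (\<lambda>x y. f x (- y)) = ennreal (J 2)"
    "0 \<le> J 3 \<and> wedge_integral c d (\<lambda>x y. f (- x) (- y)) = ennreal (J 3)"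
    "0 \<le> J 4 \<and> wedge_integral c b (\<lambda>x y. f (- x) y) = ennreal (J 4)"
    "0 \<le> J 5 \<and> wedge_integral b a (\<lambda>x y. f y x) = ennreal (J 5)"
    "0 \<le> J 6 \<and> wedge_integral b c (\<lambda>x y. f (- y) x) = ennreal (J 6)"
    "0 \<le> J 7 \<and> wedge_integral d c (\<lambda>x y. f (- y) (- x)) = ennreal (J 7)"
    "0 \<le> J 8 \<and> wedge_integral d a (\<lambda>x y. f y (- x)) = ennreal (J 8)"
  proof -
    have 1: "h_dist lx ly u 1 = a" by (simp add: defs)
    show "0 \<le> J 1 \<and> wedge_integral a b (\<lambda>x y. f x y) = ennreal (J 1)"
      unfolding J_def 1
      by (intro conjI wedge_integral_anticlockwise[where a = 0 and X = "\<lambda>x y. x" and Y = "\<lambda>x y. y" and k = b])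
        (use p R in \<open>simp_all add: defs\<close>)
    have 2: "h_dist lx ly u 2 = a" by (simp add: defs)
    show "0 \<le> J 2 \<and> wedge_integral a d (\<lambda>x y. f x (- y)) = ennreal (J 2)"
      unfolding J_def 2
      by (intro conjI wedge_integral_clockwise[where a = "2 * pi" and X = "\<lambda>x y. x" and Y = "\<lambda>x y. - y" and k = d])
        (use p R in \<open>simp_all add: defs cos_diff sin_diff\<close>)
    have 3: "h_dist lx ly u 3 = c" by (simp add: defs)
    show "0 \<le> J 3 \<and> wedge_integral c d (\<lambda>x y. f (- x) (- y)) = ennreal (J 3)"
      unfolding J_def 3
      by (intro conjI wedge_integral_anticlockwise[where a = pi and X = "\<lambda>x y. - x" and Y = "\<lambda>x y. - y" and k = d])
        (use p R in \<open>simp_all add: defs cos_add sin_add\<close>)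
    have 4: "h_dist lx ly u 4 = c" by (simp add: defs)
    show "0 \<le> J 4 \<and> wedge_integral c b (\<lambda>x y. f (- x) y) = ennreal (J 4)"
      unfolding J_def 4
      by (intro conjI wedge_integral_clockwise[where a = pi and X = "\<lambda>x y. - x" and Y = "\<lambda>x y. y" and k = b])
        (use p R in \<open>simp_all add: defs cos_diff sin_diff\<close>)
    have 5: "h_dist lx ly u 5 = b" by (simp add: defs)
    show "0 \<le> J 5 \<and> wedge_integral b a (\<lambda>x y. f y x) = ennreal (J 5)"
      unfolding J_def 5
      by (intro conjI wedge_integral_clockwise[where a = "pi / 2" and X = "\<lambda>x y. y" and Y = "\<lambda>x y. x" and k = a])
        (use p R in \<open>simp_all add: defs cos_diff sin_diff arctan_divide_swap[of a b]\<close>)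
    have 6: "h_dist lx ly u 6 = b" by (simp add: defs)
    show "0 \<le> J 6 \<and> wedge_integral b c (\<lambda>x y. f (- y) x) = ennreal (J 6)"
      unfolding J_def 6
      by (intro conjI wedge_integral_anticlockwise[where a = "pi / 2" and X = "\<lambda>x y. - y" and Y = "\<lambda>x y. x" and k = c])
        (use p R in \<open>simp_all add: defs cos_add sin_add arctan_divide_swap[of c b]\<close>)
    have 7: "h_dist lx ly u 7 = d" by (simp add: defs)
    show "0 \<le> J 7 \<and> wedge_integral d c (\<lambda>x y. f (- y) (- x)) = ennreal (J 7)"
      unfolding J_def 7
      by (intro conjI wedge_integral_clockwise[where a = "3 * pi / 2" and X = "\<lambda>x y. - y" and Y = "\<lambda>x y. - x" and k = c])
        (use p R in \<open>simp_all add: defs cos_diff sin_diff cos3 arctan_divide_swap[of c d]\<close>)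
    have 8: "h_dist lx ly u 8 = d" by (simp add: defs)
    show "0 \<le> J 8 \<and> wedge_integral d a (\<lambda>x y. f y (- x)) = ennreal (J 8)"
      unfolding J_def 8
      by (intro conjI wedge_integral_anticlockwise[where a = "3 * pi / 2" and X = "\<lambda>x y. y" and Y = "\<lambda>x y. - x" and k = a])
        (use p R in \<open>simp_all add: defs cos_add sin_add cos3 arctan_divide_swap[of a d]\<close>)
  qed
  have "{1..8::nat} = {1, 2, 3, 4, 5, 6, 7, 8}" by auto
  then have sum: "(\<Sum>i=1..8. J i) = J 1 + J 2 + J 3 + J 4 + J 5 + J 6 + J 7 + J 8"
    by simp
  show "0 \<le> (\<Sum>i=1..8. J i)"
    unfolding sum using sec by simp
  show "(\<integral>\<^sup>+x. (\<integral>\<^sup>+y. ennreal (f x y) * indicator {h_ym ly u<..<h_yp ly u} y \<partial>lborel) *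
       indicator {h_xm lx u<..<h_xp lx u} x \<partial>lborel) = ennreal (\<Sum>i=1..8. J i)"
    unfolding h_eq sum using sec
    by (subst rectangle_integral_wedges[OF p]) simp_all
qed

section \<open>The coverage probability\<close>

theorem corollary9:
  fixes M :: "'a measure"
    and lx ly \<xi> \<tau> \<alpha> \<rho> N0 t :: real
    and u :: "real \<times> real"
    and g :: "real \<Rightarrow> real"
    and V :: "'a \<Rightarrow> real \<times> real"
    and \<beta> :: "'a \<Rightarrow> complex"
  assumes "prob_space M"
    and "lx > 0" and "ly > 0"
    and "\<bar>fst u\<bar> < lx / 2" and "\<bar>snd u\<bar> < ly / 2"
    and "\<tau> > 0" and "\<alpha> > 0" and "\<rho> > 0" and "N0 > 0"
    and "g \<in> borel_measurable borel" and "\<And>x. g x > 0"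
    and "distributed M lborel V
           (\<lambda>v. indicator (rectangle lx ly) v / measure lborel (rectangle lx ly))"
    and "distributed M lborel (\<lambda>\<omega>. (cmod (\<beta> \<omega>))\<^sup>2) (exponential_density 1)"
    and "prob_space.indep_set M
           {V -` A \<inter> space M | A. A \<in> sets borel}
           {(\<lambda>\<omega>. (cmod (\<beta> \<omega>))\<^sup>2) -` A \<inter> space M | A. A \<in> sets borel}"
    and "t > 0"
  shows "measure M {\<omega> \<in> space M. SNR g \<xi> \<tau> \<alpha> \<rho> N0 u (V \<omega>) ((cmod (\<beta> \<omega>))\<^sup>2) \<ge> t} =
    1 / (lx * ly) *
    (\<Sum>i=1..8.
       (LBINT r=0..h_dist lx ly u i. r * sector_integral g \<xi> \<tau> \<alpha> \<rho> N0 t (chi_lt lx ly u i) r) +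
       (LBINT r=h_dist lx ly u i..r_max lx ly u.
          r * sector_integral g \<xi> \<tau> \<alpha> \<rho> N0 t (chi_ge lx ly u i) r))"
proof -
  interpret prob_space M by fact
  note V = assms(12) and B = assms(13)
  note [measurable] = assms(10)
  define X where "X \<omega> = (cmod (\<beta> \<omega>))\<^sup>2" for \<omega>
  have X_eq: "X = (\<lambda>\<omega>. (cmod (\<beta> \<omega>))\<^sup>2)"
    by (simp add: X_def fun_eq_iff)
  define G where "G r \<theta> = exp (- (t * N0 * (\<tau> * r) powr \<alpha> / (\<rho> * g (\<theta> - \<xi>))))" for r \<theta>
  define F where "F w = G (polar_radius w) (polar_angle w)" for w
  \<comment> \<open>\<open>c v\<close> is the least fading gain that gives coverage at a position
    \<open>v \<noteq> u\<close>, and \<open>exp (- c v)\<close> equals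
    \<open>F (v - u)\<close>.\<close>
  define c where "c v = t * N0 * (\<tau> * polar_radius (v - u)) powr \<alpha> / (\<rho> * g (polar_angle (v - u) - \<xi>))" for v
  have [measurable]: "case_prod G \<in> borel_measurable (borel \<Otimes>\<^sub>M borel)"
    unfolding G_def by measurable
  have [measurable]: "polar_radius \<in> borel_measurable borel"
    unfolding polar_radius_def by measurable
  have F_meas [measurable]: "F \<in> borel_measurable borel"
    unfolding F_def by measurable
  have c_meas [measurable]: "c \<in> borel_measurable borel"
    unfolding c_def by measurable
  have c_nn: "0 \<le> c v" for v
    using assms(8,9,15) assms(11)[of "polar_angle (v - u) - \<xi>"] by (simp add: c_def)
  have rv [measurable]: "random_variable borel V" "random_variable borel X"
    using distributed_measurable[OF V] distributed_measurable[OF B] by (simp_all add: X_eq)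
  have dist_V: "distr M borel V = density lborel (\<lambda>v. ennreal (1 / (lx * ly)) * indicator (rectangle lx ly) v)"
  proof -
    have "distr M borel V = distr M lborel V" by (rule distr_cong) auto
    also have "\<dots> = density lborel (\<lambda>v. ennreal (1 / (lx * ly)) * indicator (rectangle lx ly) v)"
      unfolding distributed_distr_eq_density[OF V] using assms
      by (intro density_cong) (auto simp: measure_rectangle split: split_indicator)
    finally show ?thesis .
  qed
  \<comment> \<open>At \<open>v = u\<close> the threshold \<open>c v\<close> is \<open>0\<close>,
    but \<open>powr\<close> makes the SNR \<open>0\<close> as well and thus less than
    \<open>t\<close>. This point must be removed before \<open>SNR_iff\<close> can be used; the law
    of \<open>V\<close> gives it no mass.\<close>
  have "AE v in distr M borel V. v \<noteq> u"
    unfolding dist_V using AE_lborel_singleton[of u]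
    by (subst AE_density) (auto elim: eventually_mono)
  then have AE_V: "AE \<omega> in M. V \<omega> \<noteq> u"
    by (rule AE_distrD[rotated]) measurable
  have SNR_iff: "t \<le> SNR g \<xi> \<tau> \<alpha> \<rho> N0 u v x \<longleftrightarrow> c v \<le> x" if "v \<noteq> u" for v x
  proof -
    have "0 < \<tau> * polar_radius (v - u)" using that assms by (simp add: polar_radius_def)
    then have "0 < (\<tau> * polar_radius (v - u)) powr \<alpha>"
      by (metis powr_gt_zero less_irrefl)
    moreover have "0 < g (polar_angle (v - u) - \<xi>)" by fact
    ultimately show ?thesis
      using assms(8,9) by (simp add: SNR_def c_def powr_minus field_simps)
  qed
  have pos: "0 < h_xp lx u" "h_xm lx u < 0" "0 < h_yp ly u" "h_ym ly u < 0"
    using assms(4,5) by (auto simp: h_xp_def h_xm_def h_yp_def h_ym_def abs_less_iff)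
  interpret polar_density "\<lambda>x y. F (x, y)" G "r_max lx ly u"
  proof
    show "(\<lambda>(x, y). F (x, y)) \<in> borel_measurable (borel \<Otimes>\<^sub>M borel)"
      by (simp add: borel_prod)
    show "F (r * cos \<theta>, r * sin \<theta>) = G r \<theta>" if "0 < r" "0 \<le> \<theta>" "\<theta> < 2 * pi" for r \<theta>
      using that by (simp add: F_def polar_radius_polar polar_angle_polar)
    show "G r \<theta> \<le> 1" for r \<theta>
      using assms(8,9,15) assms(11)[of "\<theta> - \<xi>"] by (simp add: G_def)
  qed (auto simp: F_def G_def)
  define S where "S = (\<Sum>i=1..8. arc_bounds_integral G (h_dist lx ly u i) (r_max lx ly u)
      (chi_lt lx ly u i) (chi_ge lx ly u i))"
  have S_nn: "0 \<le> S"
    unfolding S_def by (rule rectangle_integral_polar[OF refl pos])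
  have [measurable]: "random_variable borel (\<lambda>\<omega>. SNR g \<xi> \<tau> \<alpha> \<rho> N0 u (V \<omega>) (X \<omega>))"
    unfolding SNR_def by measurable
  have "emeasure M {\<omega> \<in> space M. t \<le> SNR g \<xi> \<tau> \<alpha> \<rho> N0 u (V \<omega>) (X \<omega>)} =
      emeasure M {\<omega> \<in> space M. c (V \<omega>) \<le> X \<omega>}"
    using AE_V by (intro emeasure_eq_AE) (auto simp: SNR_iff elim!: eventually_mono)
  also have "\<dots> = (\<integral>\<^sup>+v. ennreal (exp (- c v)) \<partial>distr M borel V)"
    unfolding X_eq by (rule emeasure_exponential_ge[OF rv(1) assms(14) B c_meas c_nn])
  also have "\<dots> = (\<integral>\<^sup>+v. ennreal (1 / (lx * ly)) * (ennreal (F (v - u)) * indicator (rectangle lx ly) v) \<partial>lborel)"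
    unfolding dist_V by (subst nn_integral_density) (auto simp: c_def F_def G_def ac_simps)
  also have "\<dots> = ennreal (1 / (lx * ly)) * (\<integral>\<^sup>+v. ennreal (F (v - u)) * indicator (rectangle lx ly) v \<partial>lborel)"
    by (rule nn_integral_cmult) measurable
  also have "(\<integral>\<^sup>+v. ennreal (F (v - u)) * indicator (rectangle lx ly) v \<partial>lborel) =
      (\<integral>\<^sup>+x. (\<integral>\<^sup>+y. ennreal (F (x, y)) * indicator {h_ym ly u<..<h_yp ly u} y \<partial>lborel) *
       indicator {h_xm lx u<..<h_xp lx u} x \<partial>lborel)"
    by (rule nn_integral_rectangle_translate) measurable
  also have "\<dots> = ennreal S"
    unfolding S_def by (rule rectangle_integral_polar[OF refl pos])
  also have "ennreal (1 / (lx * ly)) * ennreal S = ennreal (1 / (lx * ly) * S)"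
    using assms(2,3) S_nn by (intro ennreal_mult[symmetric]) auto
  finally have "measure M {\<omega> \<in> space M. t \<le> SNR g \<xi> \<tau> \<alpha> \<rho> N0 u (V \<omega>) (X \<omega>)} = 1 / (lx * ly) * S"
    using assms(2,3) S_nn by (simp add: emeasure_eq_measure)
  \<comment> \<open>With the exponential integrand as \<open>G r\<close>, the two notions agree by
    definition, so \<open>S\<close> is the required sum.\<close>
  moreover have "sector_integral g \<xi> \<tau> \<alpha> \<rho> N0 t chi r = arc_integral (G r) (fst (chi r)) (snd (chi r))" for chi r
    by (simp add: sector_integral_def arc_integral_def G_def)
  ultimately show ?thesis
    by (simp only: X_def S_def arc_bounds_integral_def)
qed

end
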